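(* Let $\mathfrak{K}_+$ be a separable Hilbert space and let $V(\lambda)=V_0+\lambda V_1$, $\lambda\in\mathbb{T}$, be an isometric linear pencil of operators on $\mathfrak{K}_+$. Set $$\mathfrak{V}:=\bigvee_{\lambda\in\mathbb{T}}V(\lambda)\mathfrak{K}_+=\overline{V_0\mathfrak{K}_+}\oplus\overline{V_1\mathfrak{K}_+},\qquad \mathfrak{L}:=\mathfrak{K}_+\ominus\mathfrak{V},\qquad \mathfrak{K}_\lambda:=\mathfrak{V}\ominus V(\lambda)\mathfrak{K}_+\quad(\lambda\in\mathbb{T}),$$ (the sum $\overline{V_0\mathfrak{K}_+}\oplus\overline{V_1\mathfrak{K}_+}$ being orthogonal), define operators on $\mathfrak{V}$ by $$P(\lambda):=P_{\overline{V_0\mathfrak{K}_+}}+\lambda P_{\overline{V_1\mathfrak{K}_+}}\qquad(\lambda\in\mathbb{T}),$$ set $\mathfrak{U}:=\mathfrak{K}_1\oplus\mathfrak{L}$ (where $\mathfrak{K}_1$ is $\mathfrak{K}_\lambda$ for $\lambda=1$), and define $Q(\lambda):\mathfrak{U}\to\mathfrak{K}_+$ by $$Q(\lambda)(k\oplus l):=P(\lambda)k+l\qquad(k\in\mathfrak{K}_1,\ l\in\mathfrak{L},\ \lambda\in\mathbb{T}).$$ Let $\mathfrak{K}:=\mathfrak{K}_+\oplus\left(\bigoplus_{n=1}^{\infty}\mathfrak{U}\right)$ and for $\lambda\in\mathbb{T}$ define $U(\lambda):\mathfrak{K}\to\mathfrak{K}$ by $$U(\lambda)(k_+,u_1,u_2,u_3,\ldots):=(V(\lambda)k_++Q(\lambda)u_1,\,u_2,\,u_3,\,\ldots).$$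 Then $U(\lambda)$, $\lambda\in\mathbb{T}$, is a minimal unitary extension of the isometric linear pencil $V(\lambda)$.
   Context: Hilbert spaces are complex; subspaces are closed; $\mathbb{T}=\{\lambda\in\mathbb{C}:|\lambda|=1\}$; $P_{\mathfrak{M}}$ is the orthogonal projector onto a subspace $\mathfrak{M}$; $A|\mathfrak{M}$ is the restriction of $A$ to $\mathfrak{M}$; $\bigvee$ denotes the closure of the linear span of the indicated subsets; $\ominus$ denotes orthogonal complement. A vector $k_+\in\mathfrak{K}_+$ is identified with $(k_+,0,0,\ldots)\in\mathfrak{K}$. A linear pencil on a Hilbert space is a family $A(\lambda)=A_0+\lambda A_1$, $\lambda\in\mathbb{T}$, with $A_0,A_1$ bounded linear operators on it. It is called isometric (resp. unitary) if $A(\lambda)$ is an isometry (resp. a unitary operator) for every $\lambda\in\mathbb{T}$. A unitary linear pencil $U(\lambda)=U_0+\lambda U_1$ on a Hilbert space $\mathfrak{K}\supset\mathfrak{K}_+$ is a unitary extension of an isometric linear pencil $V(\lambda)$ on $\mathfrak{K}_+$ if $\mathfrak{K}_+$ is invariant under all $U(\lambda)$, $\lambda\in\mathbb{T}$, and $V(\lambda)=U(\lambda)|\mathfrak{K}_+$ for all $\lambda\in\mathbb{T}$. A unitary extension $U(\lambda)$ of $V(\lambda)$ is minimal if it is minimal in the natural partial order on the set of all unitary extensions of $V(\lambda)$; that is, whenever $\mathfrak{K}'$ is a subspace with $\mathfrak{K}_+\subset\mathfrak{K}'\subset\mathfrak{K}$ such that the compressed pencil $U'(\lambda)=P_{\mathfrak{K}'}U(\lambda)|\mathfrak{K}'$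 is a unitary extension of $V(\lambda)$, then $\mathfrak{K}'=\mathfrak{K}$. *)

theory Defs
  imports "HOL-Analysis.Analysis"
begin

section \<open>Complex Hilbert spaces\<close>

class complex_vector = real_vector +
  fixes scaleC :: "complex \<Rightarrow> 'a \<Rightarrow> 'a"  (infixr "*\<^sub>C" 75)
  assumes scaleC_add_right: "a *\<^sub>C (x + y) = a *\<^sub>C x + a *\<^sub>C y"
    and scaleC_add_left: "(a + b) *\<^sub>C x = a *\<^sub>C x + b *\<^sub>C x"
    and scaleC_scaleC: "a *\<^sub>C b *\<^sub>C x = (a * b) *\<^sub>C x"
    and scaleR_scaleC: "r *\<^sub>R x = complex_of_real r *\<^sub>C x"

lemma scaleC_one: "1 *\<^sub>C x = (x :: 'a :: complex_vector)"
  using scaleR_scaleC[of 1 x] by simp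

global_interpretation complex_vector: vector_space "scaleC :: complex \<Rightarrow> 'a \<Rightarrow> 'a :: complex_vector"
  defines csubspace = complex_vector.subspace
    and cspan = complex_vector.span
  by unfold_locales (simp_all add: scaleC_add_right scaleC_add_left scaleC_scaleC scaleC_one)

text \<open>
  The inner product is linear in the first argument. Its real part is the library's
  real inner product, which also provides the norm: \<open>norm x = sqrt (Re (cinner x x))\<close>.
\<close>

class complex_inner = complex_vector + real_inner +
  fixes cinner :: "'a \<Rightarrow> 'a \<Rightarrow> complex"
  assumes cinner_commute: "cinner x y = cnj (cinner y x)"
    and cinner_add_left: "cinner (x + y) z = cinner x z + cinner y z"
    and cinner_scaleC_left: "cinner (a *\<^sub>C x) y = a * cinner x y"
    and Re_cinner: "Re (cinner x y) = inner x y"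

class chilbert_space = complex_inner + complete_space

lemma cinner_scaleC_right: "cinner x (a *\<^sub>C y) = cnj a * cinner x y"
  by (metis cinner_commute cinner_scaleC_left complex_cnj_mult)

lemma cinner_self: "cinner x x = complex_of_real ((norm x)\<^sup>2)"
proof -
  have "Im (cinner x x) = 0"
    using arg_cong[OF cinner_commute[of x x], of Im] by simp
  then show ?thesis
    by (simp add: complex_eq_iff Re_cinner dot_square_norm)
qed

lemma cinner_eq_Complex: "cinner x y = Complex (inner x y) (inner x (\<i> *\<^sub>C y))"
proof -
  have "inner x (\<i> *\<^sub>C y) = Im (cinner x y)"
    using Re_cinner[of x "\<i> *\<^sub>C y"] by (simp add: cinner_scaleC_right)
  then show ?thesis
    by (simp add: complex_eq_iff Re_cinner)
qed

lemma norm_scaleC: "norm (a *\<^sub>C x) = cmod a * norm (x :: 'a :: complex_inner)"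
proof -
  have "complex_of_real ((norm (a *\<^sub>C x))\<^sup>2) = (a * cnj a) * cinner x x"
    by (simp only: cinner_self[symmetric] cinner_scaleC_left cinner_scaleC_right ac_simps)
  also have "\<dots> = complex_of_real ((cmod a * norm x)\<^sup>2)"
    by (simp only: complex_norm_square[symmetric] cinner_self of_real_mult[symmetric]
        power_mult_distrib of_real_power[symmetric])
  finally have "(norm (a *\<^sub>C x))\<^sup>2 = (cmod a * norm x)\<^sup>2"
    by (simp only: of_real_eq_iff)
  then show ?thesis
    by (simp add: power2_eq_iff_nonneg)
qed

instantiation complex :: chilbert_space
begin

definition scaleC_complex_def: "a *\<^sub>C z = a * (z :: complex)"
definition cinner_complex_def: "cinner z w = z * cnj w"

instance
  by standard
    (simp_all add: scaleC_complex_def cinner_complex_def scaleR_conv_of_real inner_complex_def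
      algebra_simps)

end

instantiation prod :: (complex_vector, complex_vector) complex_vector
begin

definition scaleC_prod_def: "a *\<^sub>C z = (a *\<^sub>C fst z, a *\<^sub>C snd z)"

instance
  by standard
    (simp_all add: scaleC_prod_def scaleC_add_right scaleC_add_left scaleC_scaleC
      scaleR_prod_def scaleR_scaleC prod_eq_iff)

end

instantiation prod :: (complex_inner, complex_inner) complex_inner
begin

definition cinner_prod_def: "cinner z w = cinner (fst z) (fst w) + cinner (snd z) (snd w)"

instance
proof
  fix x y z :: "'a \<times> 'b" and a :: complex
  show "cinner x y = cnj (cinner y x)"
    by (metis cinner_commute cinner_prod_def complex_cnj_add)
qed (simp_all add: cinner_prod_def scaleC_prod_def cinner_add_left cinner_scaleC_left
      Re_cinner inner_prod_def algebra_simps)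

end

instance prod :: (chilbert_space, chilbert_space) chilbert_space ..

section \<open>Square-summable sequences\<close>

text \<open>The countable orthogonal sum of copies of a Hilbert space.\<close>

lemma norm_add_square_le:
  fixes x y :: "'a :: real_normed_vector"
  shows "(norm (x + y))\<^sup>2 \<le> 2 * (norm x)\<^sup>2 + 2 * (norm y)\<^sup>2"
proof -
  have "(norm (x + y))\<^sup>2 \<le> (norm x + norm y)\<^sup>2"
    by (simp add: norm_triangle_ineq power_mono)
  also have "\<dots> \<le> 2 * (norm x)\<^sup>2 + 2 * (norm y)\<^sup>2"
    using sum_squares_bound[of "norm x" "norm y"] by (simp add: power2_sum)
  finally show ?thesis .
qed

typedef (overloaded) 'a ell2 =
  "{f :: nat \<Rightarrow> 'a :: real_normed_vector. summable (\<lambda>n. (norm (f n))\<^sup>2)}"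
  morphisms ell2_nth Abs_ell2
  by (rule exI[of _ "\<lambda>_. 0"]) simp

setup_lifting type_definition_ell2

lemma summable_ell2_nth: "summable (\<lambda>n. (norm (ell2_nth f n))\<^sup>2)"
  using ell2_nth by blast

lemma ell2_eqI: "(\<And>n. ell2_nth f n = ell2_nth g n) \<Longrightarrow> f = g"
  by (metis ell2_nth_inject ext)

lemma summable_ell2_add:
  fixes f g :: "nat \<Rightarrow> 'a :: real_normed_vector"
  assumes "summable (\<lambda>n. (norm (f n))\<^sup>2)" "summable (\<lambda>n. (norm (g n))\<^sup>2)"
  shows "summable (\<lambda>n. (norm (f n + g n))\<^sup>2)"
proof (rule summable_comparison_test')
  show "summable (\<lambda>n. 2 * (norm (f n))\<^sup>2 + 2 * (norm (g n))\<^sup>2)"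
    by (intro summable_add summable_mult assms)
qed (use norm_add_square_le in auto)

instantiation ell2 :: (real_normed_vector) real_vector
begin

lift_definition zero_ell2 :: "'a ell2" is "\<lambda>_. 0" by simp
lift_definition plus_ell2 :: "'a ell2 \<Rightarrow> 'a ell2 \<Rightarrow> 'a ell2" is "\<lambda>f g n. f n + g n"
  by (rule summable_ell2_add)
lift_definition uminus_ell2 :: "'a ell2 \<Rightarrow> 'a ell2" is "\<lambda>f n. - f n" by simp
lift_definition minus_ell2 :: "'a ell2 \<Rightarrow> 'a ell2 \<Rightarrow> 'a ell2" is "\<lambda>f g n. f n - g n"
  using summable_ell2_add[of _ "\<lambda>n. - _ n"] by simp
lift_definition scaleR_ell2 :: "real \<Rightarrow> 'a ell2 \<Rightarrow> 'a ell2" is "\<lambda>r f n. r *\<^sub>R f n"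
  by (simp add: power_mult_distrib summable_mult)

instance
  by standard (transfer; simp add: algebra_simps; fail)+

end

lemma summable_ell2_inner:
  fixes f g :: "nat \<Rightarrow> 'a :: real_inner"
  assumes "summable (\<lambda>n. (norm (f n))\<^sup>2)" "summable (\<lambda>n. (norm (g n))\<^sup>2)"
  shows "summable (\<lambda>n. inner (f n) (g n))"
proof (rule summable_comparison_test')
  show "summable (\<lambda>n. (norm (f n))\<^sup>2 + (norm (g n))\<^sup>2)"
    by (intro summable_add assms)
  fix n
  have "\<bar>inner (f n) (g n)\<bar> \<le> norm (f n) * norm (g n)"
    by (rule Cauchy_Schwarz_ineq2)
  moreover have "2 * (norm (f n) * norm (g n)) \<le> (norm (f n))\<^sup>2 + (norm (g n))\<^sup>2"
    using sum_squares_bound[of "norm (f n)" "norm (g n)"] by (simp add: mult.assoc)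
  moreover have "0 \<le> norm (f n) * norm (g n)"
    by simp
  ultimately show "norm (inner (f n) (g n)) \<le> (norm (f n))\<^sup>2 + (norm (g n))\<^sup>2"
    unfolding real_norm_def by linarith
qed

instantiation ell2 :: (real_inner) real_inner
begin

lift_definition inner_ell2 :: "'a ell2 \<Rightarrow> 'a ell2 \<Rightarrow> real" is "\<lambda>f g. \<Sum>n. inner (f n) (g n)" .

definition norm_ell2 :: "'a ell2 \<Rightarrow> real" where "norm_ell2 f = sqrt (inner f f)"
definition sgn_ell2 :: "'a ell2 \<Rightarrow> 'a ell2" where "sgn_ell2 f = f /\<^sub>R norm f"
definition dist_ell2 :: "'a ell2 \<Rightarrow> 'a ell2 \<Rightarrow> real" where "dist_ell2 f g = norm (f - g)"
definition uniformity_ell2 :: "('a ell2 \<times> 'a ell2) filter"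
  where "uniformity_ell2 = (INF e\<in>{0<..}. principal {(f, g). dist f g < e})"
definition open_ell2 :: "'a ell2 set \<Rightarrow> bool"
  where "open_ell2 S \<longleftrightarrow> (\<forall>f\<in>S. \<forall>\<^sub>F (f', g) in uniformity. f' = f \<longrightarrow> g \<in> S)"

instance
proof
  fix f g h :: "'a ell2" and r :: real and S :: "'a ell2 set"
  show "dist f g = norm (f - g)" "sgn f = f /\<^sub>R norm f" "norm f = sqrt (inner f f)"
    "uniformity = (INF e\<in>{0<..}. principal {(f, g). dist f (g :: 'a ell2) < e})"
    "open S \<longleftrightarrow> (\<forall>f\<in>S. \<forall>\<^sub>F (f', g) in uniformity. f' = f \<longrightarrow> g \<in> S)"
    by (simp_all add: dist_ell2_def sgn_ell2_def norm_ell2_def uniformity_ell2_def open_ell2_def)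
  show "inner f g = inner g f"
    by transfer (simp add: inner_commute)
  show "inner (f + g) h = inner f h + inner g h"
    by transfer (simp add: inner_add_left suminf_add summable_ell2_inner)
  show "inner (r *\<^sub>R f) g = r * inner f g"
    by transfer (simp add: suminf_mult summable_ell2_inner)
  show "0 \<le> inner f f"
    by transfer (simp add: suminf_nonneg summable_ell2_inner)
  show "inner f f = 0 \<longleftrightarrow> f = 0"
    by transfer (simp add: suminf_eq_zero_iff summable_ell2_inner fun_eq_iff)
qed

end

lemma norm_square_ell2: "(norm f)\<^sup>2 = (\<Sum>n. (norm (ell2_nth f n))\<^sup>2)"
  unfolding power2_norm_eq_inner inner_ell2.rep_eq ..

lemma sum_norm_ell2_nth_le: "(\<Sum>n<N. (norm (ell2_nth f n))\<^sup>2) \<le> (norm f)\<^sup>2"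
  unfolding norm_square_ell2 by (rule sum_le_suminf) (auto simp: summable_ell2_nth)

lemma norm_ell2_nth_le: "norm (ell2_nth f n) \<le> norm f"
proof -
  have "(norm (ell2_nth f n))\<^sup>2 \<le> (\<Sum>i<Suc n. (norm (ell2_nth f i))\<^sup>2)"
    by (simp add: sum_nonneg)
  also have "\<dots> \<le> (norm f)\<^sup>2"
    by (rule sum_norm_ell2_nth_le)
  finally show ?thesis
    by (rule power2_le_imp_le) simp
qed

instantiation ell2 :: (complex_inner) complex_inner
begin

lift_definition scaleC_ell2 :: "complex \<Rightarrow> 'a ell2 \<Rightarrow> 'a ell2" is "\<lambda>a f n. a *\<^sub>C f n"
  by (simp add: norm_scaleC power_mult_distrib summable_mult)

lift_definition cinner_ell2 :: "'a ell2 \<Rightarrow> 'a ell2 \<Rightarrow> complex" is "\<lambda>f g. \<Sum>n. cinner (f n) (g n)" .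

lemma summable_cinner_ell2: "summable (\<lambda>n. cinner (ell2_nth f n) (ell2_nth g n))"
proof -
  have "summable (\<lambda>n. inner (ell2_nth f n) (ell2_nth g n))"
    "summable (\<lambda>n. inner (ell2_nth f n) (\<i> *\<^sub>C ell2_nth g n))"
    by (auto intro!: summable_ell2_inner summable_ell2_nth simp: norm_scaleC)
  then show ?thesis
    by (simp add: cinner_eq_Complex summable_complex_iff)
qed

instance
proof
  fix f g h :: "'a ell2" and a b :: complex and r :: real
  show "a *\<^sub>C (f + g) = a *\<^sub>C f + a *\<^sub>C g" "(a + b) *\<^sub>C f = a *\<^sub>C f + b *\<^sub>C f"
    "a *\<^sub>C b *\<^sub>C f = (a * b) *\<^sub>C f" "r *\<^sub>R f = complex_of_real r *\<^sub>C f"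
    by (transfer; simp add: scaleC_add_right scaleC_add_left scaleC_scaleC scaleR_scaleC; fail)+
  show "cinner (f + g) h = cinner f h + cinner g h"
    by (simp add: cinner_ell2.rep_eq plus_ell2.rep_eq cinner_add_left suminf_add
        summable_cinner_ell2)
  show "cinner (a *\<^sub>C f) g = a * cinner f g"
    by (simp add: cinner_ell2.rep_eq scaleC_ell2.rep_eq cinner_scaleC_left suminf_mult
        summable_cinner_ell2)
  show "Re (cinner f g) = inner f g"
    by (simp add: cinner_ell2.rep_eq inner_ell2.rep_eq Re_suminf summable_cinner_ell2 Re_cinner)
  have "(\<lambda>n. cnj (cinner (ell2_nth g n) (ell2_nth f n))) sums cnj (cinner g f)"
    unfolding cinner_ell2.rep_eq sums_cnj by (rule summable_sums[OF summable_cinner_ell2])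
  then show "cinner f g = cnj (cinner g f)"
    by (simp add: cinner_ell2.rep_eq cinner_commute[symmetric] sums_iff)
qed

end

instance ell2 :: (chilbert_space) chilbert_space
proof
  fix X :: "nat \<Rightarrow> 'a ell2"
  assume X: "Cauchy X"
  have "Cauchy (\<lambda>k. ell2_nth (X k) n)" for n
  proof (rule metric_CauchyI)
    fix e :: real
    assume "e > 0"
    then obtain M where M: "\<And>m k. m \<ge> M \<Longrightarrow> k \<ge> M \<Longrightarrow> dist (X m) (X k) < e"
      using X unfolding Cauchy_def by blast
    have "dist (ell2_nth (X m) n) (ell2_nth (X k) n) \<le> dist (X m) (X k)" for m k
      using norm_ell2_nth_le[of "X m - X k" n] by (simp add: dist_norm minus_ell2.rep_eq)
    then show "\<exists>M. \<forall>m\<ge>M. \<forall>k\<ge>M. dist (ell2_nth (X m) n) (ell2_nth (X k) n) < e"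
      using M by (meson le_less_trans)
  qed
  then have "\<forall>n. \<exists>l. (\<lambda>k. ell2_nth (X k) n) \<longlonglongrightarrow> l"
    by (simp add: Cauchy_convergent_iff convergent_def)
  then obtain L where L: "\<And>n. (\<lambda>k. ell2_nth (X k) n) \<longlonglongrightarrow> L n"
    by metis
  have tail: "\<exists>M. \<forall>m\<ge>M. \<forall>p. (\<Sum>n<p. (norm (ell2_nth (X m) n - L n))\<^sup>2) \<le> e\<^sup>2"
    if "e > 0" for e :: real
  proof -
    obtain M where M: "\<And>m k. m \<ge> M \<Longrightarrow> k \<ge> M \<Longrightarrow> dist (X m) (X k) < e"
      using X \<open>e > 0\<close> unfolding Cauchy_def by blast
    have "(\<Sum>n<p. (norm (ell2_nth (X m) n - L n))\<^sup>2) \<le> e\<^sup>2" if "m \<ge> M" for m p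
    proof (rule tendsto_upperbound)
      show "(\<lambda>k. \<Sum>n<p. (norm (ell2_nth (X m) n - ell2_nth (X k) n))\<^sup>2)
          \<longlonglongrightarrow> (\<Sum>n<p. (norm (ell2_nth (X m) n - L n))\<^sup>2)"
        by (intro tendsto_intros L)
      have "(\<Sum>n<p. (norm (ell2_nth (X m) n - ell2_nth (X k) n))\<^sup>2) \<le> e\<^sup>2" if "k \<ge> M" for k
      proof -
        have "(\<Sum>n<p. (norm (ell2_nth (X m) n - ell2_nth (X k) n))\<^sup>2) \<le> (norm (X m - X k))\<^sup>2"
          using sum_norm_ell2_nth_le[of "X m - X k" p] by (simp add: minus_ell2.rep_eq)
        also have "\<dots> \<le> e\<^sup>2"
          using M[OF \<open>m \<ge> M\<close> \<open>k \<ge> M\<close>] by (intro power_mono) (auto simp: dist_norm)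
        finally show ?thesis .
      qed
      then show "\<forall>\<^sub>F k in sequentially.
          (\<Sum>n<p. (norm (ell2_nth (X m) n - ell2_nth (X k) n))\<^sup>2) \<le> e\<^sup>2"
        by (rule eventually_sequentiallyI)
    qed simp
    then show ?thesis
      by blast
  qed
  have summable_diff: "summable (\<lambda>n. (norm (ell2_nth (X m) n - L n))\<^sup>2)"
    if "\<And>p. (\<Sum>n<p. (norm (ell2_nth (X m) n - L n))\<^sup>2) \<le> e\<^sup>2" for m and e :: real
    by (rule bounded_imp_summable[where B = "e\<^sup>2"])
      (use that[of "Suc _"] in \<open>auto simp: lessThan_Suc_atMost\<close>)
  obtain M1 where M1: "\<And>m p. m \<ge> M1 \<Longrightarrow> (\<Sum>n<p. (norm (ell2_nth (X m) n - L n))\<^sup>2) \<le> 1\<^sup>2"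
    using tail[of 1] by auto
  have "summable (\<lambda>n. (norm (ell2_nth (X M1) n + - (ell2_nth (X M1) n - L n)))\<^sup>2)"
    using summable_diff[OF M1[OF order_refl]]
    by (intro summable_ell2_add summable_ell2_nth) (simp add: norm_minus_commute)
  then have "summable (\<lambda>n. (norm (L n))\<^sup>2)"
    by simp
  then have nth_L: "ell2_nth (Abs_ell2 L) = L"
    by (simp add: Abs_ell2_inverse)
  have "X \<longlonglongrightarrow> Abs_ell2 L"
  proof (rule metric_LIMSEQ_I)
    fix e :: real
    assume "e > 0"
    then obtain M
      where M: "\<And>m p. m \<ge> M \<Longrightarrow> (\<Sum>n<p. (norm (ell2_nth (X m) n - L n))\<^sup>2) \<le> (e / 2)\<^sup>2"
      using tail[of "e / 2"] by auto
    have "dist (X m) (Abs_ell2 L) < e" if "m \<ge> M" for m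
    proof -
      have "(norm (X m - Abs_ell2 L))\<^sup>2 = (\<Sum>n. (norm (ell2_nth (X m) n - L n))\<^sup>2)"
        by (simp add: norm_square_ell2 minus_ell2.rep_eq nth_L)
      also have "\<dots> \<le> (e / 2)\<^sup>2"
        using suminf_le_const[OF summable_diff[OF M[OF that]]] M[OF that] by blast
      finally have "norm (X m - Abs_ell2 L) \<le> e / 2"
        by (rule power2_le_imp_le) (use \<open>e > 0\<close> in simp)
      then show ?thesis
        using \<open>e > 0\<close> by (simp add: dist_norm)
    qed
    then show "\<exists>M. \<forall>m\<ge>M. dist (X m) (Abs_ell2 L) < e"
      by blast
  qed
  then show "convergent X"
    by (rule convergentI)
qed

lift_definition ell2_shift :: "'a :: real_normed_vector ell2 \<Rightarrow> 'a ell2" is "\<lambda>f n. f (Suc n)"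
  by (simp add: summable_Suc_iff[of "\<lambda>n. (norm (_ n))\<^sup>2"])

section \<open>Subspaces\<close>

definition closed_csubspace :: "'a :: complex_inner set \<Rightarrow> bool"
  where "closed_csubspace M \<longleftrightarrow> csubspace M \<and> closed M"

definition ominus :: "'a :: complex_inner set \<Rightarrow> 'a set \<Rightarrow> 'a set"  (infixl "\<ominus>" 65)
  where "M \<ominus> N = {x \<in> M. \<forall>y\<in>N. cinner x y = 0}"

definition is_orthogonal_sum :: "'a :: complex_inner set \<Rightarrow> 'a set \<Rightarrow> 'a set \<Rightarrow> bool"
  where "is_orthogonal_sum S M N \<longleftrightarrow>
    (\<forall>x\<in>M. \<forall>y\<in>N. cinner x y = 0) \<and> S = {x + y | x y. x \<in> M \<and> y \<in> N}"

text \<open>The orthogonal projector; meaningful for a closed subspace of a Hilbert space.\<close>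

definition proj :: "'a :: complex_inner set \<Rightarrow> 'a \<Rightarrow> 'a"
  where "proj M x = (THE y. y \<in> M \<and> (\<forall>z\<in>M. cinner (x - y) z = 0))"

section \<open>Linear pencils\<close>

text \<open>
  The Hilbert spaces on which pencils act are closed subspaces \<open>M\<close> of a type of class
  \<^class>\<open>chilbert_space\<close> (possibly the whole type). An operator on \<open>M\<close> is a function on the
  type of which only the values on \<open>M\<close> matter.
\<close>

definition bounded_operator_on :: "'a :: complex_inner set \<Rightarrow> ('a \<Rightarrow> 'a) \<Rightarrow> bool"
  where "bounded_operator_on M A \<longleftrightarrow>
    (\<forall>x\<in>M. A x \<in> M) \<and>
    (\<forall>x\<in>M. \<forall>y\<in>M. A (x + y) = A x + A y) \<and>
    (\<forall>a. \<forall>x\<in>M. A (a *\<^sub>C x) = a *\<^sub>C A x) \<and>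
    (\<exists>B. \<forall>x\<in>M. norm (A x) \<le> B * norm x)"

abbreviation unit_circle :: "complex set"  ("\<bbbT>")
  where "\<bbbT> \<equiv> sphere 0 1"

definition pencil :: "('a :: complex_inner \<Rightarrow> 'a) \<Rightarrow> ('a \<Rightarrow> 'a) \<Rightarrow> complex \<Rightarrow> 'a \<Rightarrow> 'a"
  where "pencil A0 A1 z x = A0 x + z *\<^sub>C A1 x"

definition linear_pencil :: "'a :: chilbert_space set \<Rightarrow> (complex \<Rightarrow> 'a \<Rightarrow> 'a) \<Rightarrow> bool"
  where "linear_pencil M A \<longleftrightarrow> closed_csubspace M \<and>
    (\<exists>A0 A1. bounded_operator_on M A0 \<and> bounded_operator_on M A1 \<and>
      (\<forall>z\<in>\<bbbT>. \<forall>x\<in>M. A z x = pencil A0 A1 z x))"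

definition isometric_pencil :: "'a :: chilbert_space set \<Rightarrow> (complex \<Rightarrow> 'a \<Rightarrow> 'a) \<Rightarrow> bool"
  where "isometric_pencil M A \<longleftrightarrow>
    linear_pencil M A \<and> (\<forall>z\<in>\<bbbT>. \<forall>x\<in>M. norm (A z x) = norm x)"

text \<open>A unitary operator is a surjective linear isometry.\<close>

definition unitary_pencil :: "'a :: chilbert_space set \<Rightarrow> (complex \<Rightarrow> 'a \<Rightarrow> 'a) \<Rightarrow> bool"
  where "unitary_pencil M A \<longleftrightarrow> isometric_pencil M A \<and> (\<forall>z\<in>\<bbbT>. A z ` M = M)"

definition unitary_extension ::
  "'a :: chilbert_space set \<Rightarrow> (complex \<Rightarrow> 'a \<Rightarrow> 'a) \<Rightarrow> 'a set \<Rightarrow> (complex \<Rightarrow> 'a \<Rightarrow> 'a) \<Rightarrow> bool"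
  where "unitary_extension Kp V K U \<longleftrightarrow>
    isometric_pencil Kp V \<and> unitary_pencil K U \<and> Kp \<subseteq> K \<and>
    (\<forall>z\<in>\<bbbT>. \<forall>x\<in>Kp. U z x \<in> Kp) \<and>
    (\<forall>z\<in>\<bbbT>. \<forall>x\<in>Kp. V z x = U z x)"

definition minimal_unitary_extension ::
  "'a :: chilbert_space set \<Rightarrow> (complex \<Rightarrow> 'a \<Rightarrow> 'a) \<Rightarrow> 'a set \<Rightarrow> (complex \<Rightarrow> 'a \<Rightarrow> 'a) \<Rightarrow> bool"
  where "minimal_unitary_extension Kp V K U \<longleftrightarrow>
    unitary_extension Kp V K U \<and>
    (\<forall>K'. closed_csubspace K' \<and> Kp \<subseteq> K' \<and> K' \<subseteq> K \<and>
      unitary_extension Kp V K' (\<lambda>z x. proj K' (U z x)) \<longrightarrow> K' = K)"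

section \<open>The extension\<close>

text \<open>
  Here \<open>\<KK>\<^sub>+\<close> is the whole type \<open>'a\<close>, and \<open>V0\<close>, \<open>V1\<close> are the coefficients of the
  isometric pencil.
\<close>

definition spaceV :: "('a :: chilbert_space \<Rightarrow> 'a) \<Rightarrow> ('a \<Rightarrow> 'a) \<Rightarrow> 'a set"
  where "spaceV V0 V1 = closure (cspan (\<Union>z\<in>\<bbbT>. range (pencil V0 V1 z)))"

definition spaceL :: "('a :: chilbert_space \<Rightarrow> 'a) \<Rightarrow> ('a \<Rightarrow> 'a) \<Rightarrow> 'a set"
  where "spaceL V0 V1 = UNIV \<ominus> spaceV V0 V1"

definition spaceK :: "('a :: chilbert_space \<Rightarrow> 'a) \<Rightarrow> ('a \<Rightarrow> 'a) \<Rightarrow> complex \<Rightarrow> 'a set"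
  where "spaceK V0 V1 z = spaceV V0 V1 \<ominus> range (pencil V0 V1 z)"

definition opP :: "('a :: chilbert_space \<Rightarrow> 'a) \<Rightarrow> ('a \<Rightarrow> 'a) \<Rightarrow> complex \<Rightarrow> 'a \<Rightarrow> 'a"
  where "opP V0 V1 z = pencil (proj (closure (range V0))) (proj (closure (range V1))) z"

text \<open>\<open>k \<oplus> l\<close> is the pair \<open>(k, l)\<close>; products carry the Hilbert norm.\<close>

definition spaceU :: "('a :: chilbert_space \<Rightarrow> 'a) \<Rightarrow> ('a \<Rightarrow> 'a) \<Rightarrow> ('a \<times> 'a) set"
  where "spaceU V0 V1 = spaceK V0 V1 1 \<times> spaceL V0 V1"

definition opQ :: "('a :: chilbert_space \<Rightarrow> 'a) \<Rightarrow> ('a \<Rightarrow> 'a) \<Rightarrow> complex \<Rightarrow> 'a \<times> 'a \<Rightarrow> 'a"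
  where "opQ V0 V1 z = (\<lambda>(k, l). opP V0 V1 z k + l)"

text \<open>
  A vector \<open>(k, u\<^sub>1, u\<^sub>2, \<dots>)\<close> is \<open>(k, u)\<close> with \<open>u\<^sub>n = ell2_nth u (n - 1)\<close>.
\<close>

definition ext_space ::
  "('a :: chilbert_space \<Rightarrow> 'a) \<Rightarrow> ('a \<Rightarrow> 'a) \<Rightarrow> ('a \<times> ('a \<times> 'a) ell2) set"
  where "ext_space V0 V1 = UNIV \<times> {u. \<forall>n. ell2_nth u n \<in> spaceU V0 V1}"

definition ext_pencil ::
  "('a :: chilbert_space \<Rightarrow> 'a) \<Rightarrow> ('a \<Rightarrow> 'a) \<Rightarrow> complex \<Rightarrow>
    'a \<times> ('a \<times> 'a) ell2 \<Rightarrow> 'a \<times> ('a \<times> 'a) ell2"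
  where "ext_pencil V0 V1 z =
    (\<lambda>(k, u). (pencil V0 V1 z k + opQ V0 V1 z (ell2_nth u 0), ell2_shift u))"

text \<open>The copy of \<open>\<KK>\<^sub>+\<close> inside the extension space, and a pencil transported to it.\<close>

definition incl :: "'a :: chilbert_space \<Rightarrow> 'a \<times> ('a \<times> 'a) ell2"
  where "incl k = (k, 0)"

definition incl_pencil ::
  "(complex \<Rightarrow> 'a :: chilbert_space \<Rightarrow> 'a) \<Rightarrow> complex \<Rightarrow>
    'a \<times> ('a \<times> 'a) ell2 \<Rightarrow> 'a \<times> ('a \<times> 'a) ell2"
  where "incl_pencil A z x = incl (A z (fst x))"

end

theory Submission
  imports Defs
begin

text \<open>
  Comparing the norms of \<open>V(\<lambda>)x\<close> for different \<open>\<lambda>\<close> shows that \<open>V\<^sub>0\<close> and \<open>V\<^sub>1\<close> have orthogonal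
  ranges, so \<open>P(\<lambda>)\<close> is unitary on \<open>\<VV>\<close> and carries \<open>V(1)\<close> to \<open>V(\<lambda>)\<close>, hence \<open>\<KK>\<^sub>1\<close> onto \<open>\<KK>\<^sub>\<lambda>\<close>.
  Therefore \<open>\<KK>\<^sub>+ = V(\<lambda>)\<KK>\<^sub>+ \<oplus> P(\<lambda>)\<KK>\<^sub>1 \<oplus> \<LL>\<close>, which makes \<open>U(\<lambda>)\<close> a surjective isometry.
  If the compression to \<open>\<KK>'\<close> is again unitary, then \<open>\<KK>'\<close> reduces every \<open>U(\<lambda>)\<close>; pulling \<open>\<KK>\<^sub>+\<close>
  back repeatedly by \<open>U(1)\<close> puts each copy of the defect space \<open>\<UU>\<close> into \<open>\<KK>'\<close>.
\<close>

section \<open>Inner products and orthogonal projections\<close>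

lemma cinner_add_right: "cinner x (y + z) = cinner x y + cinner x z"
  by (metis cinner_add_left cinner_commute complex_cnj_add)

lemma cinner_zero_left [simp]: "cinner 0 x = 0"
  using cinner_add_left[of 0 0 x] by simp

lemma cinner_zero_right [simp]: "cinner x 0 = 0"
  using cinner_add_right[of x 0 0] by simp

lemma cinner_diff_left: "cinner (x - y) z = cinner x z - cinner y z"
  using cinner_add_left[of "x - y" y z] by simp

lemma cinner_eq_zero_commute: "cinner x y = 0 \<longleftrightarrow> cinner y x = 0"
  by (metis cinner_commute complex_cnj_zero_iff)

lemma cinner_self_eq_zero: "cinner x x = 0 \<longleftrightarrow> x = 0"
  by (simp add: cinner_self)

lemma norm_add_square_orthogonal:
  assumes "cinner x y = 0"
  shows "(norm (x + y))\<^sup>2 = (norm x)\<^sup>2 + (norm y)\<^sup>2"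
proof -
  have "inner x y = 0"
    using assms Re_cinner[of x y] by simp
  then show ?thesis
    by (simp add: power2_norm_eq_inner inner_add_left inner_add_right inner_commute)
qed

lemma bounded_linear_scaleC: "bounded_linear (\<lambda>x :: 'a :: complex_inner. a *\<^sub>C x)"
  by (rule bounded_linear_intro[where K = "cmod a"])
    (simp_all add: scaleC_add_right norm_scaleC scaleR_scaleC scaleC_scaleC mult.commute)

text \<open>By \<open>cinner_eq_Complex\<close>, vanishing of the complex inner product amounts to
  two real equations, each continuous in \<open>x\<close>.\<close>

lemma closed_cinner_eq_zero: "closed {x. cinner x y = 0}"
proof -
  have "{x. cinner x y = 0} = {x. inner x y = 0} \<inter> {x. inner x (\<i> *\<^sub>C y) = 0}"
    by (auto simp: cinner_eq_Complex complex_eq_iff)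
  then show ?thesis
    by (auto intro!: closed_Int closed_Collect_eq continuous_intros)
qed

text \<open>The closures are taken one argument at a time, because the annihilator of a single
  vector is closed.\<close>

lemma closure_orthogonal:
  assumes "\<And>x y. x \<in> A \<Longrightarrow> y \<in> B \<Longrightarrow> cinner x y = 0" "x \<in> closure A" "y \<in> closure B"
  shows "cinner x y = 0"
proof -
  have *: "cinner x y = 0" if "y \<in> B" "x \<in> closure A" for x y
    using closure_minimal[OF _ closed_cinner_eq_zero, of A y] assms(1) that by auto
  then have "closure B \<subseteq> {y. cinner y x = 0}"
    using assms(2) cinner_eq_zero_commute
    by (intro closure_minimal closed_cinner_eq_zero) blast
  then show ?thesis
    using assms(3) cinner_eq_zero_commute by blast
qed

section \<open>Closed complex subspaces\<close>

lemma csubspaceI: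
  assumes "0 \<in> M" "\<And>x y. x \<in> M \<Longrightarrow> y \<in> M \<Longrightarrow> x + y \<in> M" "\<And>a x. x \<in> M \<Longrightarrow> a *\<^sub>C x \<in> M"
  shows "csubspace M"
  using assms unfolding complex_vector.subspace_def by blast

lemma csubspace_imp_subspace: "csubspace M \<Longrightarrow> subspace M"
  by (simp add: subspace_def scaleR_scaleC complex_vector.subspace_0 complex_vector.subspace_add
      complex_vector.subspace_scale)

lemma closed_csubspace_closure:
  fixes M :: "'a :: complex_inner set"
  assumes "csubspace M"
  shows "closed_csubspace (closure M)"
  unfolding closed_csubspace_def
proof (intro conjI csubspaceI)
  show "0 \<in> closure M"
    using assms complex_vector.subspace_0 closure_subset by blast
  show "x + y \<in> closure M" if xy: "x \<in> closure M" "y \<in> closure M" for x y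
  proof -
    obtain f g where "\<And>n. f n \<in> M" "f \<longlonglongrightarrow> x" "\<And>n. g n \<in> M" "g \<longlonglongrightarrow> y"
      using xy unfolding closure_sequential by blast
    then have "\<And>n. f n + g n \<in> M" "(\<lambda>n. f n + g n) \<longlonglongrightarrow> x + y"
      using assms by (auto intro: complex_vector.subspace_add tendsto_add)
    then show ?thesis
      unfolding closure_sequential by (intro exI[of _ "\<lambda>n. f n + g n"] conjI allI)
  qed
  fix a x
  assume "x \<in> closure M"
  moreover have "(\<lambda>x. a *\<^sub>C x) ` closure M \<subseteq> closure ((\<lambda>x. a *\<^sub>C x) ` M)"
    using closure_bounded_linear_image_subset[OF bounded_linear_scaleC] .
  moreover have "(\<lambda>x. a *\<^sub>C x) ` M \<subseteq> M"
    using assms complex_vector.subspace_scale by blast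
  ultimately show "a *\<^sub>C x \<in> closure M"
    using closure_mono by blast
qed simp

lemma closed_csubspace_ominus:
  assumes "closed_csubspace M"
  shows "closed_csubspace (M \<ominus> N)"
proof -
  have "M \<ominus> N = M \<inter> (\<Inter>y\<in>N. {x. cinner x y = 0})"
    by (auto simp: ominus_def)
  moreover have "closed \<dots>"
    using assms by (auto simp: closed_csubspace_def intro!: closed_Int closed_INT closed_cinner_eq_zero)
  moreover have "csubspace (M \<ominus> N)"
    using assms by (intro csubspaceI)
      (auto simp: ominus_def closed_csubspace_def cinner_add_left cinner_scaleC_left
        complex_vector.subspace_0 complex_vector.subspace_add complex_vector.subspace_scale)
  ultimately show ?thesis
    by (simp add: closed_csubspace_def)
qed

lemma closed_csubspace_Times:
  assumes "closed_csubspace M" "closed_csubspace N"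
  shows "closed_csubspace (M \<times> N)"
proof -
  have "csubspace (M \<times> N)"
    using assms by (intro csubspaceI)
      (auto simp: closed_csubspace_def scaleC_prod_def zero_prod_def complex_vector.subspace_0
        complex_vector.subspace_add complex_vector.subspace_scale)
  then show ?thesis
    using assms by (simp add: closed_csubspace_def closed_Times)
qed

section \<open>Nearest points and existence of the orthogonal projection\<close>

lemma closest_point_orthogonal:
  fixes M :: "'a :: real_inner set"
  assumes "subspace M" "y \<in> M" and le: "\<And>w. w \<in> M \<Longrightarrow> norm (x - y) \<le> norm (x - w)"
    and "z \<in> M"
  shows "inner (x - y) z = 0"
proof (cases "z = 0")
  case False
  \<comment> \<open>This \<open>t\<close> minimises the quadratic
    \<open>norm (x - y - t *\<^sub>R z)\<close> squared, so a nonzero inner product would bring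
    \<open>y + t *\<^sub>R z\<close> strictly closer to \<open>x\<close> than
    \<open>y\<close>.\<close>
  define t where "t = inner (x - y) z / (norm z)\<^sup>2"
  have "y + t *\<^sub>R z \<in> M"
    using assms by (simp add: subspace_add subspace_scale)
  then have "(norm (x - y))\<^sup>2 \<le> (norm ((x - y) - t *\<^sub>R z))\<^sup>2"
    using le by (simp add: diff_diff_eq power_mono)
  also have "\<dots> = (norm (x - y))\<^sup>2 - 2 * t * inner (x - y) z + t\<^sup>2 * (norm z)\<^sup>2"
    unfolding power2_norm_eq_inner
    by (simp add: inner_diff_left inner_diff_right inner_commute power2_eq_square algebra_simps)
  also have "\<dots> = (norm (x - y))\<^sup>2 - (inner (x - y) z)\<^sup>2 / (norm z)\<^sup>2"
    using False by (simp add: t_def power2_eq_square)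
  finally have "(inner (x - y) z)\<^sup>2 / (norm z)\<^sup>2 \<le> 0"
    by simp
  then show ?thesis
    using False by (simp add: divide_le_0_iff)
qed simp

text \<open>Completeness takes the place of compactness: by the parallelogram law every minimising
  sequence is Cauchy.\<close>

lemma closest_point_exists_complete:
  fixes M :: "'a :: {real_inner, complete_space} set"
  assumes "convex M" "closed M" "M \<noteq> {}"
  obtains y where "y \<in> M" "\<And>w. w \<in> M \<Longrightarrow> norm (x - y) \<le> norm (x - w)"
proof -
  define d where "d = infdist x M"
  have d_nonneg: "d \<ge> 0"
    by (simp add: d_def infdist_nonneg)
  have d_le: "d \<le> norm (x - w)" if "w \<in> M" for w
    using infdist_le[OF that, of x] by (simp add: d_def dist_norm)
  have near: "\<exists>y\<in>M. (norm (x - y))\<^sup>2 < d\<^sup>2 + e" if "e > 0" for e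
  proof -
    have "d < sqrt (d\<^sup>2 + e)"
      using that d_nonneg by (simp add: real_less_rsqrt)
    then obtain y where "y \<in> M" "dist x y < sqrt (d\<^sup>2 + e)"
      using cInf_lessD[of "dist x ` M"] assms(3) by (auto simp: d_def infdist_def)
    then have "(norm (x - y))\<^sup>2 < (sqrt (d\<^sup>2 + e))\<^sup>2"
      by (intro power_strict_mono) (auto simp: dist_norm)
    then show ?thesis
      using \<open>y \<in> M\<close> that by auto
  qed
  have "\<exists>y. y \<in> M \<and> (norm (x - y))\<^sup>2 < d\<^sup>2 + inverse (real (Suc n))" for n
    using near[of "inverse (real (Suc n))"] by auto
  then obtain Y where Y: "\<And>n. Y n \<in> M" "\<And>n. (norm (x - Y n))\<^sup>2 < d\<^sup>2 + inverse (real (Suc n))"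
    by metis
  have diff: "(norm (Y m - Y n))\<^sup>2 \<le> 2 * inverse (real (Suc m)) + 2 * inverse (real (Suc n))" for m n
  proof -
    \<comment> \<open>The midpoint stays in \<open>M\<close> by convexity, so its distance to
      \<open>x\<close> is at least \<open>d\<close>; the parallelogram identity then bounds the gap
      between \<open>Y m\<close> and \<open>Y n\<close>.\<close>
    have "(1/2) *\<^sub>R Y m + (1/2) *\<^sub>R Y n \<in> M"
      using assms(1) Y(1) by (intro convexD) auto
    then have "d\<^sup>2 \<le> (norm (x - ((1/2) *\<^sub>R Y m + (1/2) *\<^sub>R Y n)))\<^sup>2"
      using d_le d_nonneg by (intro power_mono)
    moreover have "(norm (Y m - Y n))\<^sup>2 + 4 * (norm (x - ((1/2) *\<^sub>R Y m + (1/2) *\<^sub>R Y n)))\<^sup>2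
        = 2 * (norm (x - Y m))\<^sup>2 + 2 * (norm (x - Y n))\<^sup>2"
      unfolding power2_norm_eq_inner
      by (simp add: inner_diff_left inner_diff_right inner_add_left inner_add_right inner_commute
          algebra_simps)
    ultimately show ?thesis
      using Y(2)[of m] Y(2)[of n] by linarith
  qed
  have "Cauchy Y"
  proof (rule metric_CauchyI)
    fix e :: real
    assume "e > 0"
    then obtain N where N: "inverse (real (Suc N)) < e\<^sup>2 / 4"
      using reals_Archimedean[of "e\<^sup>2 / 4"] by auto
    have "dist (Y m) (Y n) < e" if "m \<ge> N" "n \<ge> N" for m n
    proof -
      have "inverse (real (Suc m)) \<le> inverse (real (Suc N))"
        "inverse (real (Suc n)) \<le> inverse (real (Suc N))"
        using that by (auto intro!: le_imp_inverse_le)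
      then have "(norm (Y m - Y n))\<^sup>2 < e\<^sup>2"
        using diff[of m n] N by linarith
      then show ?thesis
        using \<open>e > 0\<close> by (simp add: dist_norm power2_less_imp_less)
    qed
    then show "\<exists>N. \<forall>m\<ge>N. \<forall>n\<ge>N. dist (Y m) (Y n) < e"
      by blast
  qed
  then obtain y where y: "Y \<longlonglongrightarrow> y"
    using Cauchy_convergent convergent_def by blast
  then have "y \<in> M"
    using assms(2) Y(1) closed_sequentially by blast
  moreover have "(norm (x - y))\<^sup>2 \<le> d\<^sup>2"
  proof (rule LIMSEQ_le)
    show "(\<lambda>n. (norm (x - Y n))\<^sup>2) \<longlonglongrightarrow> (norm (x - y))\<^sup>2"
      by (intro tendsto_intros y)
    show "(\<lambda>n. d\<^sup>2 + inverse (real (Suc n))) \<longlonglongrightarrow> d\<^sup>2"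
      using tendsto_add[OF tendsto_const LIMSEQ_inverse_real_of_nat] by simp
  qed (use Y(2) less_imp_le in blast)
  then have "norm (x - y) \<le> d"
    using d_nonneg by (rule power2_le_imp_le)
  ultimately show ?thesis
    using that d_le by (meson order_trans)
qed

text \<open>Uniqueness for the definite description: the difference of two candidates lies in
  \<open>M\<close> and is orthogonal to itself.\<close>

lemma proj_eqI:
  assumes "csubspace M" "y \<in> M" "\<And>z. z \<in> M \<Longrightarrow> cinner (x - y) z = 0"
  shows "proj M x = y"
  unfolding proj_def
proof (rule the_equality)
  fix w
  assume w: "w \<in> M \<and> (\<forall>z\<in>M. cinner (x - w) z = 0)"
  then have "w - y \<in> M"
    using assms complex_vector.subspace_diff by blast
  then have "cinner (x - y) (w - y) = 0" "cinner (x - w) (w - y) = 0"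
    using assms w by auto
  then have "cinner (w - y) (w - y) = 0"
    by (simp add: cinner_diff_left)
  then show "w = y"
    by (simp add: cinner_self_eq_zero)
qed (use assms in auto)

lemma
  fixes M :: "'a :: chilbert_space set"
  assumes "closed_csubspace M"
  shows proj_in: "proj M x \<in> M"
    and proj_orthogonal: "z \<in> M \<Longrightarrow> cinner (x - proj M x) z = 0"
proof -
  have M: "csubspace M" "subspace M" "closed M"
    using assms csubspace_imp_subspace by (auto simp: closed_csubspace_def)
  then obtain y where y: "y \<in> M" "\<And>w. w \<in> M \<Longrightarrow> norm (x - y) \<le> norm (x - w)"
    using closest_point_exists_complete[of M x] subspace_0 subspace_imp_convex by blast
  \<comment> \<open>Nearest points give only real orthogonality. Since \<open>M\<close> is a complex
    subspace, it applies to \<open>z\<close> and to \<open>\<i> *\<^sub>C z\<close>, which yields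
    the real and the imaginary part.\<close>
  have *: "cinner (x - y) z = 0" if "z \<in> M" for z
    using closest_point_orthogonal[OF M(2) y that]
      closest_point_orthogonal[OF M(2) y complex_vector.subspace_scale[OF M(1) that]]
    by (simp add: cinner_eq_Complex complex_eq_iff)
  then have "proj M x = y"
    using M y by (intro proj_eqI)
  then show "proj M x \<in> M" "z \<in> M \<Longrightarrow> cinner (x - proj M x) z = 0"
    using y * by auto
qed

section \<open>Algebra and norm of the projector\<close>

lemma proj_of_mem:
  assumes "closed_csubspace M" "x \<in> M"
  shows "proj M x = x"
  using assms by (intro proj_eqI) (auto simp: closed_csubspace_def)

lemma proj_eq_zero:
  assumes "closed_csubspace M" "\<And>z. z \<in> M \<Longrightarrow> cinner x z = 0"
  shows "proj M x = 0"
  using assms by (intro proj_eqI) (auto simp: closed_csubspace_def complex_vector.subspace_0)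

lemma norm_proj_square:
  fixes M :: "'a :: chilbert_space set"
  assumes "closed_csubspace M"
  shows "(norm x)\<^sup>2 = (norm (proj M x))\<^sup>2 + (norm (x - proj M x))\<^sup>2"
proof -
  have "cinner (x - proj M x) (proj M x) = 0"
    using assms by (intro proj_orthogonal proj_in)
  then have "(norm (x - proj M x + proj M x))\<^sup>2 = (norm (x - proj M x))\<^sup>2 + (norm (proj M x))\<^sup>2"
    by (rule norm_add_square_orthogonal)
  then show ?thesis
    by simp
qed

lemma norm_proj_le:
  fixes M :: "'a :: chilbert_space set"
  assumes "closed_csubspace M"
  shows "norm (proj M x) \<le> norm x"
proof (rule power2_le_imp_le)
  show "(norm (proj M x))\<^sup>2 \<le> (norm x)\<^sup>2"
    unfolding norm_proj_square[OF assms, of x] by (rule add_increasing2) simp_all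
qed simp

text \<open>By Pythagoras, equal norms leave no room for a component orthogonal to
  \<open>M\<close>.\<close>

lemma norm_proj_eq_imp_mem:
  fixes M :: "'a :: chilbert_space set"
  assumes "closed_csubspace M" "norm (proj M x) = norm x"
  shows "x \<in> M"
proof -
  have "(norm (x - proj M x))\<^sup>2 = 0"
    using norm_proj_square[OF assms(1), of x] unfolding assms(2) by linarith
  then have "x = proj M x"
    by simp
  then show ?thesis
    using proj_in[OF assms(1)] by metis
qed

lemma proj_add:
  fixes M :: "'a :: chilbert_space set"
  assumes "closed_csubspace M"
  shows "proj M (x + y) = proj M x + proj M y"
proof (rule proj_eqI)
  have "proj M x \<in> M" "proj M y \<in> M"
    using assms proj_in by blast+
  then show "csubspace M" "proj M x + proj M y \<in> M"
    using assms by (auto simp: closed_csubspace_def complex_vector.subspace_add)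
  fix z assume "z \<in> M"
  then show "cinner (x + y - (proj M x + proj M y)) z = 0"
    using proj_orthogonal[OF assms, of z]
    by (simp add: add_diff_add cinner_add_left)
qed

lemma proj_scaleC:
  fixes M :: "'a :: chilbert_space set"
  assumes "closed_csubspace M"
  shows "proj M (a *\<^sub>C x) = a *\<^sub>C proj M x"
proof (rule proj_eqI)
  have "proj M x \<in> M"
    using assms proj_in by blast
  then show "csubspace M" "a *\<^sub>C proj M x \<in> M"
    using assms by (auto simp: closed_csubspace_def complex_vector.subspace_scale)
  fix z assume "z \<in> M"
  then show "cinner (a *\<^sub>C x - a *\<^sub>C proj M x) z = 0"
    using proj_orthogonal[OF assms, of z x]
    by (simp add: cinner_diff_left cinner_scaleC_left)
qed

section \<open>Passing between complex operators and real bounded linear maps\<close>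

lemma bounded_linear_of_bounded_operator:
  assumes "bounded_operator_on UNIV A"
  shows "bounded_linear A"
proof -
  obtain B where "\<And>x. norm (A x) \<le> B * norm x"
    using assms by (auto simp: bounded_operator_on_def)
  then show ?thesis
    using assms by (intro bounded_linear_intro[where K = B])
      (auto simp: bounded_operator_on_def scaleR_scaleC mult.commute)
qed

lemma bounded_operator_onI:
  assumes "bounded_linear A" "\<And>a x. A (a *\<^sub>C x) = a *\<^sub>C A x" "\<And>x. x \<in> M \<Longrightarrow> A x \<in> M"
  shows "bounded_operator_on M A"
proof -
  interpret bounded_linear A
    by (rule assms)
  show ?thesis
    using bounded assms(2,3) by (auto simp: bounded_operator_on_def add mult.commute)
qed

lemma bounded_operator_on_proj:
  fixes M :: "'a :: chilbert_space set"
  assumes "closed_csubspace M"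
  shows "bounded_operator_on UNIV (proj M)"
  unfolding bounded_operator_on_def
  by (auto simp: proj_add proj_scaleC assms intro!: exI[of _ 1] norm_proj_le)

section \<open>Pencils and compressions\<close>

lemma isometric_pencil_inj_on:
  assumes "isometric_pencil M A" "z \<in> \<bbbT>"
  shows "inj_on (A z) M"
proof (rule inj_onI)
  fix x y
  assume xy: "x \<in> M" "y \<in> M" "A z x = A z y"
  have "linear_pencil M A" and norm: "\<And>x. x \<in> M \<Longrightarrow> norm (A z x) = norm x"
    using assms by (simp_all add: isometric_pencil_def)
  then obtain A0 A1 where A: "bounded_operator_on M A0" "bounded_operator_on M A1"
    "\<And>x. x \<in> M \<Longrightarrow> A z x = pencil A0 A1 z x" and M: "csubspace M"
    using assms(2) unfolding linear_pencil_def closed_csubspace_def by blast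
  \<comment> \<open>\<open>bounded_operator_on\<close> offers additivity and complex homogeneity on
    \<open>M\<close> only, so the difference is treated as \<open>x + (-1) *\<^sub>C y\<close> with
    both summands in \<open>M\<close>.\<close>
  have diff: "x - y \<in> M" "(-1) *\<^sub>C y \<in> M"
    using xy M by (auto intro: complex_vector.subspace_diff simp: complex_vector.subspace_neg)
  have lin: "B (x - y) = B x - B y" if "bounded_operator_on M B" for B
  proof -
    have "B (x + (-1) *\<^sub>C y) = B x + (-1) *\<^sub>C B y"
      using that xy diff unfolding bounded_operator_on_def by metis
    then show ?thesis
      by (simp add: scaleC_one)
  qed
  have "A z (x - y) = pencil A0 A1 z x - pencil A0 A1 z y"
    unfolding A(3)[OF diff(1)]
    by (simp add: pencil_def lin[OF A(1)] lin[OF A(2)] complex_vector.scale_right_diff_distrib)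
  also have "\<dots> = 0"
    using A(3) xy by (metis diff_self)
  finally show "x = y"
    using norm[OF diff(1)] by simp
qed

text \<open>A compression of a unitary operator that is itself unitary lives on a reducing subspace.\<close>

lemma unitary_compression_mem:
  assumes U: "isometric_pencil K U" and U': "unitary_pencil K' (\<lambda>z x. proj K' (U z x))"
    and "K' \<subseteq> K" "z \<in> \<bbbT>" "x \<in> K" "U z x \<in> K'"
  shows "x \<in> K'"
proof -
  have K': "closed_csubspace K'"
    using U' by (simp add: unitary_pencil_def isometric_pencil_def linear_pencil_def)
  \<comment> \<open>\<open>U z\<close> and its compression are both isometric on \<open>K'\<close>,
    so the projection loses no norm and \<open>U z y\<close> is already in
    \<open>K'\<close>.\<close>
  have proj: "proj K' (U z y) = U z y" if "y \<in> K'" for y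
  proof (rule proj_of_mem[OF K' norm_proj_eq_imp_mem[OF K']])
    show "norm (proj K' (U z y)) = norm (U z y)"
      using assms that by (auto simp: unitary_pencil_def isometric_pencil_def)
  qed
  \<comment> \<open>Surjectivity of the compression provides a preimage inside \<open>K'\<close>;
    injectivity of \<open>U z\<close> on \<open>K\<close> then identifies it with
    \<open>x\<close>.\<close>
  obtain y where "y \<in> K'" "proj K' (U z y) = U z x"
    using assms unfolding unitary_pencil_def by (metis (no_types, lifting) imageE)
  then have "U z y = U z x" "y \<in> K"
    using proj assms(3) by auto
  then have "y = x"
    using isometric_pencil_inj_on[OF U \<open>z \<in> \<bbbT>\<close>] \<open>x \<in> K\<close> by (auto dest: inj_onD)
  then show ?thesis
    using \<open>y \<in> K'\<close> by simp
qed

section \<open>Square-summable sequences\<close>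

text \<open>A right inverse of the shift, used to build preimages under the extension.\<close>

lift_definition ell2_Cons :: "'a :: real_normed_vector \<Rightarrow> 'a ell2 \<Rightarrow> 'a ell2"
  is "\<lambda>a f n. case n of 0 \<Rightarrow> a | Suc m \<Rightarrow> f m"
  by (subst summable_Suc_iff[symmetric]) simp

lemma ell2_nth_Cons_0 [simp]: "ell2_nth (ell2_Cons a f) 0 = a"
  by transfer simp

lemma ell2_nth_Cons_Suc [simp]: "ell2_nth (ell2_Cons a f) (Suc n) = ell2_nth f n"
  by transfer simp

lemma ell2_shift_Cons [simp]: "ell2_shift (ell2_Cons a f) = f"
  by transfer simp

lemma norm_square_shift: "(norm u)\<^sup>2 = (norm (ell2_nth u 0))\<^sup>2 + (norm (ell2_shift u))\<^sup>2"
  using suminf_split_head[OF summable_ell2_nth[of u]]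
  by (simp add: norm_square_ell2 ell2_shift.rep_eq)

text \<open>These vectors span the individual copies of the defect space; minimality is proved by
  placing each of them in the smaller space.\<close>

lift_definition ell2_single :: "nat \<Rightarrow> 'a :: real_normed_vector \<Rightarrow> 'a ell2"
  is "\<lambda>n a m. if m = n then a else 0"
  by (rule summable_finite[of "{_}"]) auto

lemma cinner_ell2_single: "cinner u (ell2_single n a) = cinner (ell2_nth u n) a"
proof -
  have "cinner u (ell2_single n a) = (\<Sum>m. if m = n then cinner (ell2_nth u m) a else 0)"
    unfolding cinner_ell2.rep_eq ell2_single.rep_eq by (intro arg_cong[of _ _ suminf]) auto
  also have "\<dots> = cinner (ell2_nth u n) a"
    by (rule sums_unique[symmetric, OF sums_single])
  finally show ?thesis .
qed

lemma ell2_shift_single_0: "ell2_shift (ell2_single 0 a) = 0"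
  by transfer auto

lemma ell2_shift_single_Suc: "ell2_shift (ell2_single (Suc n) a) = ell2_single n a"
  by transfer auto

lemma ell2_shift_add: "ell2_shift (f + g) = ell2_shift f + ell2_shift g"
  by transfer auto

lemma ell2_shift_scaleC: "ell2_shift (a *\<^sub>C f) = a *\<^sub>C ell2_shift f"
  by transfer auto

lemma bounded_linear_ell2_nth: "bounded_linear (\<lambda>u :: 'a :: real_inner ell2. ell2_nth u n)"
  by (rule bounded_linear_intro[where K = 1])
    (simp_all add: plus_ell2.rep_eq scaleR_ell2.rep_eq norm_ell2_nth_le)

lemma bounded_linear_ell2_shift: "bounded_linear (ell2_shift :: 'a :: real_inner ell2 \<Rightarrow> _)"
proof (rule bounded_linear_intro[where K = 1])
  show "norm (ell2_shift u) \<le> norm u * 1" for u :: "'a ell2"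
  proof (rule power2_le_imp_le)
    show "(norm (ell2_shift u))\<^sup>2 \<le> (norm u * 1)\<^sup>2"
      unfolding mult_1_right norm_square_shift[of u] by (rule add_increasing) simp_all
  qed simp
  show "ell2_shift (r *\<^sub>R u) = r *\<^sub>R ell2_shift u" for r and u :: "'a ell2"
    by transfer simp
qed (rule ell2_shift_add)

lemma closed_csubspace_ell2:
  assumes "closed_csubspace M"
  shows "closed_csubspace {u. \<forall>n. ell2_nth u n \<in> M}"
proof -
  have "closed {u. ell2_nth u n \<in> M}" for n
    using closed_vimage[OF _ linear_continuous_on[OF bounded_linear_ell2_nth], of M n]
      assms by (simp add: closed_csubspace_def vimage_def)
  then have "closed {u. \<forall>n. ell2_nth u n \<in> M}"
    by (rule closed_Collect_all)
  moreover have "csubspace {u. \<forall>n. ell2_nth u n \<in> M}"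
    using assms by (intro csubspaceI)
      (auto simp: closed_csubspace_def zero_ell2.rep_eq plus_ell2.rep_eq scaleC_ell2.rep_eq
        complex_vector.subspace_0 complex_vector.subspace_add complex_vector.subspace_scale)
  ultimately show ?thesis
    by (simp add: closed_csubspace_def)
qed

section \<open>The two orthogonal ranges of an isometric pencil\<close>

locale isometric_pencil_coefficients =
  fixes V0 V1 :: "'a :: chilbert_space \<Rightarrow> 'a"
  assumes bounded_V0: "bounded_operator_on UNIV V0"
    and bounded_V1: "bounded_operator_on UNIV V1"
    and isometric: "isometric_pencil UNIV (pencil V0 V1)"
begin

abbreviation "R0 \<equiv> closure (range V0)"
abbreviation "R1 \<equiv> closure (range V1)"
abbreviation "P0 \<equiv> proj R0"
abbreviation "P1 \<equiv> proj R1"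
abbreviation "S \<equiv> spaceV V0 V1"
abbreviation "V \<equiv> pencil V0 V1"
abbreviation "P \<equiv> opP V0 V1"

lemma V_add: "V0 (x + y) = V0 x + V0 y" "V1 (x + y) = V1 x + V1 y"
  and V_scaleC: "V0 (a *\<^sub>C x) = a *\<^sub>C V0 x" "V1 (a *\<^sub>C x) = a *\<^sub>C V1 x"
  using bounded_V0 bounded_V1 by (auto simp: bounded_operator_on_def)

lemma pencil_add: "V z (x + y) = V z x + V z y"
  by (simp add: pencil_def V_add scaleC_add_right)

lemma pencil_scaleC: "V z (a *\<^sub>C x) = a *\<^sub>C V z x"
  by (simp add: pencil_def V_scaleC scaleC_add_right scaleC_scaleC mult.commute)

lemma norm_pencil: "z \<in> \<bbbT> \<Longrightarrow> norm (V z x) = norm x"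
  using isometric by (simp add: isometric_pencil_def)

text \<open>Comparing norms at \<open>z\<close> and \<open>- z\<close> settles the case
  \<open>x = y\<close>; polarisation extends it to arbitrary pairs.\<close>

lemma cinner_V0_V1: "cinner (V0 x) (V1 y) = 0"
proof -
  have diag: "cinner (V0 x) (V1 x) = 0" for x
  proof -
    have "inner (V0 x) (z *\<^sub>C V1 x) = 0" if "z \<in> \<bbbT>" for z
    proof -
      have "norm (V0 x + z *\<^sub>C V1 x) = norm (V0 x - z *\<^sub>C V1 x)"
        using norm_pencil[of z x] norm_pencil[of "- z" x] that by (simp add: pencil_def)
      then have "(norm (V0 x + z *\<^sub>C V1 x))\<^sup>2 = (norm (V0 x - z *\<^sub>C V1 x))\<^sup>2"
        by simp
      then show ?thesis
        unfolding power2_norm_eq_inner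
        by (simp add: inner_diff_left inner_diff_right inner_add_left inner_add_right inner_commute)
    qed
    \<comment> \<open>The points 1 and \<open>\<i>\<close> of the circle yield the real and the
      imaginary part.\<close>
    from this[of 1] this[of "\<i>"] show ?thesis
      by (simp add: cinner_eq_Complex scaleC_one complex_eq_iff)
  qed
  \<comment> \<open>Expanding the diagonal case at \<open>x + y\<close> and at
    \<open>x + \<i> *\<^sub>C y\<close> gives two independent linear equations for the two mixed
    terms, so both vanish.\<close>
  have "cinner (V0 x) (V1 y) + cinner (V0 y) (V1 x) = 0"
    using diag[of "x + y"] diag[of x] diag[of y]
    by (simp add: V_add cinner_add_left cinner_add_right add.commute)
  moreover have "- \<i> * cinner (V0 x) (V1 y) + \<i> * cinner (V0 y) (V1 x) = 0"
    using diag[of "x + \<i> *\<^sub>C y"] diag[of x] diag[of y]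
    by (simp add: V_add V_scaleC cinner_add_left cinner_add_right cinner_scaleC_left
        cinner_scaleC_right)
  ultimately show ?thesis
    by (simp add: complex_eq_iff)
qed

lemma csubspace_range_V: "csubspace (range V0)" "csubspace (range V1)"
proof -
  have *: "csubspace (range A)" if "bounded_operator_on UNIV A" for A :: "'a \<Rightarrow> 'a"
  proof (rule csubspaceI)
    have add: "A x + A y = A (x + y)" and scale: "a *\<^sub>C A x = A (a *\<^sub>C x)" for a x y
      using that by (auto simp: bounded_operator_on_def)
    show "0 \<in> range A"
      using scale[of 0 0] by (metis complex_vector.scale_zero_left rangeI)
    show "x + y \<in> range A" if "x \<in> range A" "y \<in> range A" for x y
      using that by (auto simp: add)
    show "a *\<^sub>C x \<in> range A" if "x \<in> range A" for a x
      using that by (auto simp: scale)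
  qed
  show "csubspace (range V0)" "csubspace (range V1)"
    using * bounded_V0 bounded_V1 by blast+
qed

lemma closed_csubspace_R: "closed_csubspace R0" "closed_csubspace R1"
  by (simp_all add: closed_csubspace_closure csubspace_range_V)

lemma closed_csubspace_S: "closed_csubspace S"
  unfolding spaceV_def by (intro closed_csubspace_closure complex_vector.subspace_span)

lemma cinner_R0_R1: "x \<in> R0 \<Longrightarrow> y \<in> R1 \<Longrightarrow> cinner x y = 0"
  by (rule closure_orthogonal[of "range V0" "range V1"]) (auto simp: cinner_V0_V1)

section \<open>Projections onto the two ranges\<close>

lemma P0_in: "P0 x \<in> R0" and P1_in: "P1 x \<in> R1"
  by (simp_all add: proj_in closed_csubspace_R)

lemma cinner_P0_P1: "cinner (P0 x) (P1 y) = 0" "cinner (P1 y) (P0 x) = 0"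
  using cinner_R0_R1[OF P0_in P1_in] cinner_eq_zero_commute by blast+

lemma P0_R0: "x \<in> R0 \<Longrightarrow> P0 x = x" and P1_R1: "x \<in> R1 \<Longrightarrow> P1 x = x"
  by (simp_all add: proj_of_mem closed_csubspace_R)

lemma P0_R1: "x \<in> R1 \<Longrightarrow> P0 x = 0"
  using cinner_R0_R1 cinner_eq_zero_commute by (intro proj_eq_zero closed_csubspace_R) blast

lemma P1_R0: "x \<in> R0 \<Longrightarrow> P1 x = 0"
  using cinner_R0_R1 by (intro proj_eq_zero closed_csubspace_R)

lemma P_add: "P0 (x + y) = P0 x + P0 y" "P1 (x + y) = P1 x + P1 y"
  and P_scaleC: "P0 (a *\<^sub>C x) = a *\<^sub>C P0 x" "P1 (a *\<^sub>C x) = a *\<^sub>C P1 x"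
  by (simp_all add: proj_add proj_scaleC closed_csubspace_R)

lemma V0_in: "V0 x \<in> R0" and V1_in: "V1 x \<in> R1"
  by (auto intro!: subsetD[OF closure_subset])

text \<open>Each projection fixes one range and annihilates the other, so it reads off one term of
  the pencil.\<close>

lemma P0_pencil: "P0 (V z x) = V0 x" and P1_pencil: "P1 (V z x) = z *\<^sub>C V1 x"
  by (simp_all add: pencil_def P_add P_scaleC P0_R0 P0_R1 P1_R0 P1_R1 V0_in V1_in)

lemma pencil_in_S: "z \<in> \<bbbT> \<Longrightarrow> V z x \<in> S"
  unfolding spaceV_def
  by (rule subsetD[OF closure_subset], rule complex_vector.span_base) blast

lemma S_add: "x \<in> S \<Longrightarrow> y \<in> S \<Longrightarrow> x + y \<in> S"
  and S_diff: "x \<in> S \<Longrightarrow> y \<in> S \<Longrightarrow> x - y \<in> S"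
  and S_scaleC: "x \<in> S \<Longrightarrow> a *\<^sub>C x \<in> S"
  using closed_csubspace_S
  by (simp_all add: closed_csubspace_def complex_vector.subspace_add complex_vector.subspace_diff
      complex_vector.subspace_scale)

lemma R0_subset_S: "R0 \<subseteq> S" and R1_subset_S: "R1 \<subseteq> S"
proof -
  \<comment> \<open>The values at 1 and -1 determine both coefficients, which therefore map into
    \<open>S\<close>.\<close>
  have "V 1 x + V (-1) x = 2 *\<^sub>R V0 x" "V 1 x - V (-1) x = 2 *\<^sub>R V1 x" for x
    by (simp_all add: pencil_def scaleC_one scaleR_2)
  then have "V0 x = (1/2) *\<^sub>R (V 1 x + V (-1) x)" "V1 x = (1/2) *\<^sub>R (V 1 x - V (-1) x)" for x
    by simp_all
  moreover have "V 1 x \<in> S" "V (-1) x \<in> S" for x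
    by (simp_all add: pencil_in_S)
  ultimately have "V0 x \<in> S" "V1 x \<in> S" for x
    by (metis S_add S_diff S_scaleC scaleR_scaleC)+
  then show "R0 \<subseteq> S" "R1 \<subseteq> S"
    using closed_csubspace_S by (simp_all add: closed_csubspace_def closure_minimal image_subset_iff)
qed

text \<open>The fixed set of \<open>P0 + P1\<close> is a closed complex subspace containing every
  \<open>V z x\<close>, hence it contains the closed span of these vectors.\<close>

lemma S_decomposition: "x \<in> S \<Longrightarrow> P0 x + P1 x = x"
proof -
  let ?F = "{x. P0 x + P1 x = x}"
  have "closed ?F"
    using closed_csubspace_R
    by (intro closed_Collect_eq continuous_intros linear_continuous_on
        bounded_linear_of_bounded_operator bounded_operator_on_proj)
  moreover have "cspan (\<Union>z\<in>\<bbbT>. range (V z)) \<subseteq> ?F"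
  proof (rule complex_vector.span_minimal)
    show "(\<Union>z\<in>\<bbbT>. range (V z)) \<subseteq> ?F"
      by (auto simp: P0_pencil P1_pencil) (simp add: pencil_def)
    show "csubspace ?F"
    proof (rule csubspaceI)
      have "P0 0 = 0" "P1 0 = 0"
        using P_add[of 0 0] by simp_all
      then show "0 \<in> ?F"
        by simp
      show "x + y \<in> ?F" if "x \<in> ?F" "y \<in> ?F" for x y
      proof -
        have "P0 (x + y) + P1 (x + y) = (P0 x + P1 x) + (P0 y + P1 y)"
          by (simp add: P_add)
        then show ?thesis
          using that by simp
      qed
      show "a *\<^sub>C x \<in> ?F" if "x \<in> ?F" for a x
        using that by (simp add: P_scaleC flip: scaleC_add_right)
    qed
  qed
  ultimately show "x \<in> S \<Longrightarrow> P0 x + P1 x = x"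
    unfolding spaceV_def using closure_minimal by blast
qed

lemma orthogonal_sum_S: "is_orthogonal_sum S R0 R1"
  unfolding is_orthogonal_sum_def
proof (intro conjI ballI)
  show "S = {x + y | x y. x \<in> R0 \<and> y \<in> R1}"
  proof (intro equalityI subsetI)
    show "x \<in> {x + y | x y. x \<in> R0 \<and> y \<in> R1}" if "x \<in> S" for x
      using S_decomposition[OF that, symmetric] P0_in P1_in by blast
    show "x \<in> S" if "x \<in> {x + y | x y. x \<in> R0 \<and> y \<in> R1}" for x
      using that R0_subset_S R1_subset_S S_add by blast
  qed
qed (rule cinner_R0_R1)

section \<open>The orthogonal decomposition behind the extension\<close>

lemma opP_eq: "P z x = P0 x + z *\<^sub>C P1 x"
  by (simp add: opP_def pencil_def)

lemma opP_in_S: "P z x \<in> S"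
  using P0_in P1_in R0_subset_S R1_subset_S by (auto simp: opP_eq intro!: S_add S_scaleC)

text \<open>Multiplicativity in the parameter makes \<open>P (cnj z)\<close> the inverse of
  \<open>P z\<close> on \<open>S\<close> when \<open>z\<close> lies on the circle.\<close>

lemma opP_opP: "P w (P z x) = P (w * z) x"
  by (simp add: opP_eq P_add P_scaleC P0_R0 P0_R1 P1_R0 P1_R1 P0_in P1_in scaleC_scaleC)

lemma opP_add: "P z (x + y) = P z x + P z y"
  by (simp add: opP_eq P_add scaleC_add_right)

lemma opP_1: "x \<in> S \<Longrightarrow> P 1 x = x"
  by (simp add: opP_eq scaleC_one S_decomposition)

lemma opP_pencil: "P z (V 1 x) = V z x"
  by (simp add: opP_eq P0_pencil P1_pencil scaleC_scaleC) (simp add: pencil_def)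

lemma cinner_opP:
  assumes "z \<in> \<bbbT>" "x \<in> S" "y \<in> S"
  shows "cinner (P z x) (P z y) = cinner x y"
proof -
  \<comment> \<open>The parameter enters only through \<open>z * cnj z\<close>, which is 1 on the
    circle. Thus \<open>z\<close> may be replaced by 1, where \<open>P\<close> is the identity on
    \<open>S\<close>.\<close>
  have *: "cinner (P z x) (P z y) = cinner (P0 x) (P0 y) + z * cnj z * cinner (P1 x) (P1 y)" for z
    by (simp add: opP_eq cinner_add_left cinner_add_right cinner_scaleC_left cinner_scaleC_right
        cinner_P0_P1)
  have "z * cnj z = 1"
    using assms(1) by (simp flip: complex_norm_square)
  then have "cinner (P z x) (P z y) = cinner (P 1 x) (P 1 y)"
    by (simp add: *)
  then show ?thesis
    using assms by (simp add: opP_1)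
qed

lemma norm_opP: "z \<in> \<bbbT> \<Longrightarrow> x \<in> S \<Longrightarrow> norm (P z x) = norm x"
  using cinner_opP[of z x x] by (simp add: cinner_self power2_eq_iff_nonneg flip: of_real_power)

text \<open>The three summands \<open>V z x\<close>, \<open>P z k\<close> and \<open>l\<close> are
  pairwise orthogonal, so Pythagoras applies twice.\<close>

lemma norm_extension_square:
  assumes "z \<in> \<bbbT>" "u \<in> spaceU V0 V1"
  shows "(norm (V z x + opQ V0 V1 z u))\<^sup>2 = (norm x)\<^sup>2 + (norm u)\<^sup>2"
proof -
  obtain k l where u: "u = (k, l)" and k: "k \<in> S" "\<And>y. y \<in> range (V 1) \<Longrightarrow> cinner k y = 0"
    and l: "\<And>y. y \<in> S \<Longrightarrow> cinner l y = 0"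
    using assms(2) by (auto simp: spaceU_def spaceK_def spaceL_def ominus_def)
  \<comment> \<open>\<open>P z\<close> preserves inner products on \<open>S\<close> and sends
    \<open>V 1 x\<close> to \<open>V z x\<close>, so it transports the orthogonality of
    \<open>k\<close> to \<open>V 1 x\<close>.\<close>
  have "cinner (V z x) (P z k) = 0"
    using cinner_opP[OF assms(1) k(1), of "V 1 x"] k(2)[of "V 1 x"] pencil_in_S[of 1 x]
    by (simp add: opP_pencil cinner_eq_zero_commute[of "V z x"])
  then have *: "(norm (V z x + P z k))\<^sup>2 = (norm x)\<^sup>2 + (norm k)\<^sup>2"
    using assms(1) k(1) by (simp add: norm_add_square_orthogonal norm_pencil norm_opP)
  have "cinner (V z x + P z k) l = 0"
    using l assms(1) opP_in_S pencil_in_S by (simp add: cinner_eq_zero_commute[of _ l] S_add)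
  then have "(norm (V z x + P z k + l))\<^sup>2 = (norm x)\<^sup>2 + (norm k)\<^sup>2 + (norm l)\<^sup>2"
    using * by (simp add: norm_add_square_orthogonal)
  then show ?thesis
    by (simp add: u opQ_def norm_Pair add.assoc)
qed

text \<open>An isometric image of a complete space is complete, hence closed; projecting onto
  \<open>range (V 1)\<close> is therefore legitimate.\<close>

lemma closed_csubspace_range_pencil:
  assumes "z \<in> \<bbbT>"
  shows "closed_csubspace (range (V z))"
  unfolding closed_csubspace_def
proof
  have "bounded_linear (V z)"
    using norm_pencil[OF assms]
    by (intro bounded_linear_intro[where K = 1]) (simp_all add: pencil_add pencil_scaleC scaleR_scaleC)
  then have "complete (range (V z))"
    using norm_pencil[OF assms] by (intro complete_isometric_image[of 1]) auto
  then show "closed (range (V z))"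
    by (rule complete_imp_closed)
  show "csubspace (range (V z))"
  proof (rule csubspaceI)
    show "0 \<in> range (V z)"
      using pencil_scaleC[of z 0 0] by (metis complex_vector.scale_zero_left rangeI)
  qed (auto simp flip: pencil_add pencil_scaleC)
qed

text \<open>The defect space is defined at parameter 1. The part of \<open>y\<close> in
  \<open>S\<close> is therefore rotated back by \<open>P (cnj z)\<close>, split along
  \<open>range (V 1)\<close>, and rotated forward by \<open>P z\<close>; the rest of
  \<open>y\<close> is the component in \<open>spaceL\<close>.\<close>

lemma extension_surjective:
  assumes z: "z \<in> \<bbbT>"
  obtains x u where "u \<in> spaceU V0 V1" "V z x + opQ V0 V1 z u = y"
proof -
  define v where "v = proj S y"
  define w where "w = P (cnj z) v"
  obtain x where x: "proj (range (V 1)) w = V 1 x"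
    using proj_in[OF closed_csubspace_range_pencil, of 1 w] by auto
  have "v \<in> S" "w \<in> S" "V 1 x \<in> S"
    by (simp_all add: v_def w_def proj_in closed_csubspace_S opP_in_S pencil_in_S)
  then have "w - V 1 x \<in> spaceK V0 V1 1"
    using proj_orthogonal[OF closed_csubspace_range_pencil, of 1 _ w] x
    by (auto simp: spaceK_def ominus_def intro!: S_diff)
  moreover have "y - v \<in> spaceL V0 V1"
    using proj_orthogonal[OF closed_csubspace_S] by (auto simp: spaceL_def ominus_def v_def)
  moreover have "V z x + opQ V0 V1 z (w - V 1 x, y - v) = y"
  proof -
    have "z * cnj z = 1"
      using z by (simp flip: complex_norm_square)
    then have "P z w = v"
      using \<open>v \<in> S\<close> by (simp add: w_def opP_opP opP_1)
    moreover have "P z (V 1 x + (w - V 1 x)) = V z x + P z (w - V 1 x)"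
      by (simp only: opP_add opP_pencil)
    ultimately show ?thesis
      by (simp add: opQ_def)
  qed
  ultimately show ?thesis
    using that[of "(w - V 1 x, y - v)" x] by (simp add: spaceU_def)
qed


section \<open>The extension\<close>

abbreviation "K \<equiv> ext_space V0 V1"
abbreviation "U \<equiv> ext_pencil V0 V1"

text \<open>The part of the extension that is constant in \<open>z\<close>: the shift and the
  \<open>spaceL\<close> component belong here, while \<open>E1\<close> collects what is multiplied
  by \<open>z\<close>.\<close>

definition E0 :: "'a \<times> ('a \<times> 'a) ell2 \<Rightarrow> 'a \<times> ('a \<times> 'a) ell2"
  where "E0 p = (V0 (fst p) + P0 (fst (ell2_nth (snd p) 0)) + snd (ell2_nth (snd p) 0),
    ell2_shift (snd p))"

definition E1 :: "'a \<times> ('a \<times> 'a) ell2 \<Rightarrow> 'a \<times> ('a \<times> 'a) ell2"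
  where "E1 p = (V1 (fst p) + P1 (fst (ell2_nth (snd p) 0)), 0)"

lemma ext_pencil_eq: "U z = pencil E0 E1 z"
  by (simp add: fun_eq_iff ext_pencil_def pencil_def opQ_def opP_eq E0_def E1_def scaleC_prod_def
      scaleC_add_right split: prod.split)

lemma closed_csubspace_spaceU: "closed_csubspace (spaceU V0 V1)"
proof -
  have "closed_csubspace (UNIV :: 'a set)"
    by (simp add: closed_csubspace_def)
  then show ?thesis
    unfolding spaceU_def spaceK_def spaceL_def
    by (intro closed_csubspace_Times closed_csubspace_ominus closed_csubspace_S)
qed

lemma closed_csubspace_ext_space: "closed_csubspace K"
  unfolding ext_space_def
  by (intro closed_csubspace_Times closed_csubspace_ell2 closed_csubspace_spaceU)
    (simp add: closed_csubspace_def)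

lemma bounded_operator_on_E: "bounded_operator_on K E0" "bounded_operator_on K E1"
proof -
  have bl: "bounded_linear V0" "bounded_linear V1" "bounded_linear P0" "bounded_linear P1"
    using bounded_V0 bounded_V1 closed_csubspace_R
    by (auto intro!: bounded_linear_of_bounded_operator bounded_operator_on_proj)
  have first: "bounded_linear (\<lambda>p :: 'a \<times> ('a \<times> 'a) ell2. ell2_nth (snd p) 0)"
    by (rule bounded_linear_compose[OF bounded_linear_ell2_nth bounded_linear_snd])
  have "bounded_linear E0"
    unfolding E0_def
    by (intro bounded_linear_Pair bounded_linear_add
        bounded_linear_compose[OF bl(1) bounded_linear_fst]
        bounded_linear_compose[OF bl(3) bounded_linear_compose[OF bounded_linear_fst first]]
        bounded_linear_compose[OF bounded_linear_snd first]
        bounded_linear_compose[OF bounded_linear_ell2_shift bounded_linear_snd])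
  then show "bounded_operator_on K E0"
    by (rule bounded_operator_onI)
      (auto simp: E0_def V_scaleC P_scaleC scaleC_prod_def scaleC_ell2.rep_eq ell2_shift_scaleC
        scaleC_add_right ext_space_def ell2_shift.rep_eq)
  have "bounded_linear E1"
    unfolding E1_def
    by (intro bounded_linear_Pair bounded_linear_add bounded_linear_zero
        bounded_linear_compose[OF bl(2) bounded_linear_fst]
        bounded_linear_compose[OF bl(4) bounded_linear_compose[OF bounded_linear_fst first]])
  then show "bounded_operator_on K E1"
    using closed_csubspace_spaceU
    by (intro bounded_operator_onI)
      (auto simp: E1_def V_scaleC P_scaleC scaleC_prod_def scaleC_ell2.rep_eq
        scaleC_add_right ext_space_def zero_ell2.rep_eq closed_csubspace_def
        complex_vector.subspace_0)
qed

lemma isometric_ext_pencil: "isometric_pencil K U"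
  unfolding isometric_pencil_def linear_pencil_def
proof (intro conjI exI ballI)
  show "closed_csubspace K"
    by (rule closed_csubspace_ext_space)
  show "bounded_operator_on K E0" "bounded_operator_on K E1"
    by (rule bounded_operator_on_E)+
  show "U z p = pencil E0 E1 z p" for z p
    by (simp add: ext_pencil_eq)
  fix z p
  assume z: "z \<in> \<bbbT>" and p: "p \<in> K"
  obtain k u where ku: "p = (k, u)"
    by (cases p)
  \<comment> \<open>The first entry of the sequence moves into the first coordinate without changing
    the norm, and the shift keeps the remaining entries.\<close>
  have "(norm (U z p))\<^sup>2 = (norm k)\<^sup>2 + (norm (ell2_nth u 0))\<^sup>2 + (norm (ell2_shift u))\<^sup>2"
    using norm_extension_square[OF z, of "ell2_nth u 0" k] p
    by (simp add: ku ext_pencil_def norm_Pair ext_space_def)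
  also have "\<dots> = (norm p)\<^sup>2"
    using norm_square_shift[of u] by (simp add: ku norm_Pair)
  finally show "norm (U z p) = norm p"
    by (simp add: power2_eq_iff_nonneg)
qed

lemma unitary_ext_pencil: "unitary_pencil K U"
  unfolding unitary_pencil_def
proof (intro conjI ballI equalityI subsetI)
  show "isometric_pencil K U"
    by (rule isometric_ext_pencil)
  fix z q
  assume z: "z \<in> \<bbbT>"
  show "q \<in> K" if "q \<in> U z ` K"
    using that by (auto simp: ext_space_def ext_pencil_def ell2_shift.rep_eq)
  assume q: "q \<in> K"
  obtain x a where a: "a \<in> spaceU V0 V1" "V z x + opQ V0 V1 z a = fst q"
    by (rule extension_surjective[OF z])
  \<comment> \<open>The defect vector \<open>a\<close> needed to reach \<open>fst q\<close> is
    prepended, and the shift removes it again.\<close>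
  have "U z (x, ell2_Cons a (snd q)) = q"
    by (simp add: ext_pencil_def a)
  moreover have "ell2_nth (ell2_Cons a (snd q)) n \<in> spaceU V0 V1" for n
    using a q by (cases n) (auto simp: ext_space_def)
  then have "(x, ell2_Cons a (snd q)) \<in> K"
    by (simp add: ext_space_def)
  ultimately show "q \<in> U z ` K"
    by (metis imageI)
qed

section \<open>The embedded pencil and the extension property\<close>

lemma range_incl: "range incl = UNIV \<times> {0}"
  by (auto simp: incl_def)

lemma isometric_incl_pencil: "isometric_pencil (range incl) (incl_pencil V)"
  unfolding isometric_pencil_def linear_pencil_def
proof (intro conjI exI ballI)
  show "closed_csubspace (range (incl :: 'a \<Rightarrow> _))"
    unfolding range_incl by (intro closed_csubspace_Times) (simp_all add: closed_csubspace_def)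
  have *: "bounded_operator_on (range incl) (\<lambda>x. incl (A (fst x)))"
    if "bounded_operator_on UNIV A" for A :: "'a \<Rightarrow> 'a"
  proof (rule bounded_operator_onI)
    show "bounded_linear (\<lambda>x :: 'a \<times> ('a \<times> 'a) ell2. incl (A (fst x)))"
      unfolding incl_def
      by (intro bounded_linear_Pair bounded_linear_zero
          bounded_linear_compose[OF bounded_linear_of_bounded_operator[OF that] bounded_linear_fst])
    show "incl (A (fst (a *\<^sub>C x))) = a *\<^sub>C incl (A (fst x))"
      for a and x :: "'a \<times> ('a \<times> 'a) ell2"
      using that by (simp add: incl_def scaleC_prod_def bounded_operator_on_def)
  qed simp
  show "bounded_operator_on (range incl) (\<lambda>x. incl (V0 (fst x)))"
    "bounded_operator_on (range incl) (\<lambda>x. incl (V1 (fst x)))"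
    using * bounded_V0 bounded_V1 by blast+
  show "incl_pencil V z x = pencil (\<lambda>x. incl (V0 (fst x))) (\<lambda>x. incl (V1 (fst x))) z x" for z x
    by (simp add: incl_pencil_def incl_def pencil_def scaleC_prod_def)
  show "norm (incl_pencil V z x) = norm x" if "z \<in> \<bbbT>" "x \<in> range incl" for z x
    using that by (auto simp: incl_pencil_def incl_def norm_Pair norm_pencil)
qed

lemma opQ_0: "opQ V0 V1 z 0 = 0"
  using P_add[of 0 0] by (simp add: opQ_def opP_eq zero_prod_def)

lemma ext_pencil_incl: "U z (incl k) = incl (V z k)"
proof -
  have "ell2_shift 0 = (0 :: ('a \<times> 'a) ell2)"
    by transfer simp
  then show ?thesis
    by (simp add: ext_pencil_def incl_def zero_ell2.rep_eq opQ_0)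
qed

lemma unitary_extension_ext_pencil: "unitary_extension (range incl) (incl_pencil V) K U"
  unfolding unitary_extension_def
proof (intro conjI ballI)
  show "range incl \<subseteq> K"
    using closed_csubspace_spaceU
    by (auto simp: incl_def ext_space_def zero_ell2.rep_eq closed_csubspace_def
        complex_vector.subspace_0)
  show "U z x \<in> range incl" "incl_pencil V z x = U z x" if "x \<in> range incl" for z x
    using that by (auto simp: ext_pencil_incl incl_pencil_def) (simp add: incl_def)
qed (rule isometric_incl_pencil unitary_ext_pencil)+

section \<open>Minimality\<close>

lemma ext_pencil_minimal:
  assumes K': "closed_csubspace K'" "range incl \<subseteq> K'" "K' \<subseteq> K"
    and U': "unitary_pencil K' (\<lambda>z x. proj K' (U z x))"
  shows "K' = K"
proof -
  \<comment> \<open>Membership in \<open>K'\<close> can be pulled back along \<open>U 1\<close>; the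
    single parameter 1 suffices for the rest of the argument.\<close>
  have reduce: "p \<in> K'" if "p \<in> K" "U 1 p \<in> K'" for p
    using unitary_compression_mem[OF isometric_ext_pencil U' K'(3), of 1] that by simp
  have incl_K': "(k, 0) \<in> K'" for k
    using subsetD[OF K'(2) rangeI[of incl k]] by (simp add: incl_def)
  have single_K: "(0, ell2_single n a) \<in> K" if "a \<in> spaceU V0 V1" for n a
    using that closed_csubspace_spaceU
    by (simp add: ext_space_def ell2_single.rep_eq closed_csubspace_def complex_vector.subspace_0)
  \<comment> \<open>\<open>U 1\<close> moves the copy with index 0 into the embedded base space and
    each later copy one index down, so induction on \<open>n\<close> pulls all copies into
    \<open>K'\<close>.\<close>
  have single: "(0, ell2_single n a) \<in> K'" if a: "a \<in> spaceU V0 V1" for n a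
  proof (induction n)
    case 0
    have "U 1 (0, ell2_single 0 a) \<in> K'"
      by (simp add: ext_pencil_def ell2_shift_single_0 incl_K')
    then show ?case
      by (rule reduce[OF single_K[OF a]])
  next
    case (Suc n)
    have "V 1 0 = 0"
      using pencil_add[of 1 0 0] by simp
    then have "U 1 (0, ell2_single (Suc n) a) = (0, ell2_single n a)"
      by (simp add: ext_pencil_def ell2_shift_single_Suc ell2_single.rep_eq opQ_0)
    then show ?case
      using Suc by (intro reduce[OF single_K[OF a]]) simp
  qed
  have "p \<in> K'" if "p \<in> K" for p
  proof -
    \<comment> \<open>The residual \<open>q\<close> is orthogonal to \<open>K'\<close> and lies in
      \<open>K\<close>. Testing it against its own coordinates, placed in \<open>K'\<close> by
      \<open>incl_K'\<close> and \<open>single\<close>, forces every coordinate to vanish; no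
      density argument is required.\<close>
    define q where "q = p - proj K' p"
    have "proj K' p \<in> K"
      using proj_in[OF K'(1), of p] K'(3) by blast
    then have "q \<in> K"
      unfolding q_def using closed_csubspace_ext_space that
      by (simp add: closed_csubspace_def complex_vector.subspace_diff)
    have q: "cinner q y = 0" if "y \<in> K'" for y
      unfolding q_def using proj_orthogonal[OF K'(1) that] .
    have "cinner (fst q) (fst q) = 0"
      using q[OF incl_K'[of "fst q"]] by (simp add: cinner_prod_def)
    moreover have "cinner (ell2_nth (snd q) n) (ell2_nth (snd q) n) = 0" for n
      using q[OF single[of "ell2_nth (snd q) n" n]] \<open>q \<in> K\<close>
      by (auto simp: cinner_prod_def[of q] cinner_ell2_single ext_space_def)
    then have "ell2_nth (snd q) n = ell2_nth 0 n" for n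
      by (simp add: cinner_self_eq_zero zero_ell2.rep_eq)
    then have "snd q = 0"
      by (rule ell2_eqI)
    ultimately have "q = 0"
      by (simp add: cinner_self_eq_zero prod_eq_iff)
    then show ?thesis
      using proj_in[OF K'(1), of p] by (simp add: q_def)
  qed
  then show ?thesis
    using K'(3) by blast
qed

end

theorem theorem3p2:
  fixes V0 V1 :: "'a :: chilbert_space \<Rightarrow> 'a"
  assumes "separable_space (euclidean :: 'a topology)"
    and "bounded_operator_on UNIV V0" and "bounded_operator_on UNIV V1"
    and "isometric_pencil UNIV (pencil V0 V1)"
  shows "is_orthogonal_sum (spaceV V0 V1) (closure (range V0)) (closure (range V1)) \<and>
    minimal_unitary_extension (range incl) (incl_pencil (pencil V0 V1))
      (ext_space V0 V1) (ext_pencil V0 V1)"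
proof -
  interpret isometric_pencil_coefficients V0 V1
    by unfold_locales (rule assms)+
  show ?thesis
    using orthogonal_sum_S unitary_extension_ext_pencil ext_pencil_minimal
    unfolding minimal_unitary_extension_def by (simp add: unitary_extension_def)
qed

end
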